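(* Let $S$ be an additively reduced and additively atomic semidomain for which $\mathcal{A}_{+}(S) = S^{\times}$. Suppose that $f \in S\llbracket x^{\pm 1} \rrbracket$ is not a Laurent polynomial, i.e., $f$ has infinite support. Then $|\mathfrak{R}(f)| \geq 2^{\aleph_0}$, where $\mathfrak{R}(f)$ is the set of all unordered triples $(g_1, g_2, g_3)$ with $f = g_1 + g_2 + g_3$ and each $g_i$ either $0$ or a multiplicative irreducible of $S\llbracket x^{\pm 1} \rrbracket$.
   Context: A semidomain is a subsemiring of an integral domain, i.e., a subset $S$ of an integral domain containing $0$ and $1$ and closed under addition and multiplication. $S^{\times}$ denotes the group of units of the multiplicative monoid $S^* = S\setminus\{0\}$ (elements having a multiplicative inverse in $S$). $\mathcal{A}_{+}(S)$ is the set of atoms of the additive monoid $(S,+)$: elements $a$ that are not additively invertible in $S$ and such that $a = b + c$ with $b, c \in S$ implies that $b$ or $c$ is additively invertible in $S$. $S$ is additively reduced if $0$ is the only invertible element of $(S,+)$. $S$ is additively atomic if every non-invertible element of $(S,+)$ is a sum of finitely many atoms of $(S,+)$. $S\llbracket x^{\pm 1} \rrbracket$ is the semidomain of formal Laurent series with coefficients in $S$ and only finitely many terms with negative exponent; the support of $f$ is the set of exponents of $f$ with nonzero coefficient. A multiplicative irreducible of a semidomain $T$ is a nonzero non-unit $a \in T$ such that $a = bc$ with $b, c \in T$ implies $b \in T^{\times}$ or $c \in T^{\times}$. Unordered triples are multisets of size three. *)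

theory Defs
  imports
    "HOL-Computational_Algebra.Formal_Laurent_Series"
    "HOL-Library.Multiset"
    "HOL-Library.Equipollence"
begin

text \<open>The ambient integral domain is the type \<open>'a::idom\<close>; a semidomain is a subset of it.\<close>

definition semidomain :: "'a::idom set \<Rightarrow> bool" where
  "semidomain S \<longleftrightarrow>
     0 \<in> S \<and> 1 \<in> S \<and> (\<forall>a\<in>S. \<forall>b\<in>S. a + b \<in> S) \<and> (\<forall>a\<in>S. \<forall>b\<in>S. a * b \<in> S)"

definition mult_units :: "'a::idom set \<Rightarrow> 'a set" where
  "mult_units S = {u \<in> S - {0}. \<exists>v\<in>S - {0}. u * v = 1}"

definition mult_irreducibles :: "'a::idom set \<Rightarrow> 'a set" where
  "mult_irreducibles S =
     {a \<in> S. a \<noteq> 0 \<and> a \<notin> mult_units S \<and>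
        (\<forall>b\<in>S. \<forall>c\<in>S. a = b * c \<longrightarrow> b \<in> mult_units S \<or> c \<in> mult_units S)}"

definition add_invertibles :: "'a::idom set \<Rightarrow> 'a set" where
  "add_invertibles S = {a \<in> S. \<exists>b\<in>S. a + b = 0}"

definition add_atoms :: "'a::idom set \<Rightarrow> 'a set" where
  "add_atoms S =
     {a \<in> S. a \<notin> add_invertibles S \<and>
        (\<forall>b\<in>S. \<forall>c\<in>S. a = b + c \<longrightarrow> b \<in> add_invertibles S \<or> c \<in> add_invertibles S)}"

definition additively_reduced :: "'a::idom set \<Rightarrow> bool" where
  "additively_reduced S \<longleftrightarrow> add_invertibles S = {0}"

definition additively_atomic :: "'a::idom set \<Rightarrow> bool" where
  "additively_atomic S \<longleftrightarrow>
     (\<forall>a \<in> S - add_invertibles S. \<exists>M. set_mset M \<subseteq> add_atoms S \<and> a = sum_mset M)"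

text \<open>
  Elements of type \<open>'a fls\<close> have only finitely many nonzero coefficients at negative exponents,
  so it remains to restrict the coefficients to \<open>S\<close>.
\<close>

definition laurent_series :: "'a::idom set \<Rightarrow> 'a fls set" where
  "laurent_series S = {f. \<forall>n. fls_nth f n \<in> S}"

definition fls_support :: "'a::zero fls \<Rightarrow> int set" where
  "fls_support f = {n. fls_nth f n \<noteq> 0}"

definition irreducible_triples :: "'a::idom set \<Rightarrow> 'a fls \<Rightarrow> 'a fls multiset set" where
  "irreducible_triples S f =
     {M. size M = 3 \<and> f = sum_mset M \<and>
         (\<forall>g\<in>#M. g = 0 \<or> g \<in> mult_irreducibles (laurent_series S))}"

end

theory Submission
  imports Defs
begin

unbundle fps_syntax

text \<open>
  Since \<open>S\<close> is additively reduced, the support of a product is the sumset of the supports. A set of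
  exponents that contains infinitely many \<open>K\<close> isolated in the window from \<open>K/4\<close> to \<open>2K\<close> is not a
  sumset of two sets bounded below with at least two elements each, so a series with such a support
  and with a unit
  coefficient is irreducible. Choose a rapidly growing sequence \<open>K j\<close> in the support of \<open>f\<close> and
  distribute the terms of \<open>f\<close> over two series: for each \<open>j\<close>, the term at \<open>K j\<close> goes to one of them
  and the rest of its window to the other. At two early exponents one splits off a unit, so
  that both summands have a unit coefficient. Infinitely many \<open>j\<close> remain free to
  be assigned arbitrarily, and the third summand is \<open>0\<close>.
\<close>

section \<open>Supports of products over an additively reduced semidomain\<close>

lemma semidomain_sum_in:
  assumes "semidomain S" "\<And>i. i \<in> A \<Longrightarrow> h i \<in> S"
  shows "sum h A \<in> S"
  using assms(2)
  by (induction A rule: infinite_finite_induct) (use assms(1) in \<open>auto simp: semidomain_def\<close>)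

text \<open>The sum of the remaining terms lies in \<open>S\<close> and is an additive inverse of
  \<open>h i\<close>.\<close>

lemma additively_reduced_sum_eq_0:
  assumes S: "semidomain S" "additively_reduced S"
    and A: "finite A" "\<And>i. i \<in> A \<Longrightarrow> h i \<in> S" "sum h A = 0" "i \<in> A"
  shows "h i = 0"
proof -
  have "h i + sum h (A - {i}) = 0"
    using A by (simp flip: sum.remove)
  moreover have "sum h (A - {i}) \<in> S"
    by (intro semidomain_sum_in S) (use A in auto)
  ultimately have "h i \<in> add_invertibles S"
    using A by (auto simp: add_invertibles_def)
  then show ?thesis
    using S by (simp add: additively_reduced_def)
qed

lemma fls_support_times_subset:
  fixes b c :: "'a::idom fls"
  assumes "k \<in> fls_support (b * c)"
  shows "\<exists>i\<in>fls_support b. \<exists>j\<in>fls_support c. k = i + j"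
proof -
  have "(\<Sum>i=fls_subdegree b..k - fls_subdegree c. b $$ i * c $$ (k - i)) \<noteq> 0"
    using assms by (simp add: fls_support_def fls_times_nth(2))
  then obtain i where "b $$ i * c $$ (k - i) \<noteq> 0"
    by (meson sum.not_neutral_contains_not_neutral)
  then show ?thesis
    by (intro bexI[of _ i] bexI[of _ "k - i"]) (auto simp: fls_support_def)
qed

text \<open>Nothing cancels: the coefficient is a finite sum of elements of \<open>S\<close>, and
  its term \<open>b $$ i * c $$ j\<close> is nonzero in the integral domain.\<close>

lemma fls_support_times_add:
  fixes b c :: "'a::idom fls"
  assumes S: "semidomain S" "additively_reduced S"
    and bc: "b \<in> laurent_series S" "c \<in> laurent_series S"
    and ij: "i \<in> fls_support b" "j \<in> fls_support c"
  shows "i + j \<in> fls_support (b * c)"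
proof -
  let ?k = "i + j"
  let ?A = "{fls_subdegree b..?k - fls_subdegree c}"
  have "i \<in> ?A"
    using ij by (auto simp: fls_support_def intro!: fls_subdegree_leI)
  moreover have "b $$ i * c $$ (?k - i) \<noteq> 0"
    using ij by (simp add: fls_support_def)
  moreover have "b $$ l * c $$ (?k - l) \<in> S" for l
    using S bc by (auto simp: semidomain_def laurent_series_def)
  ultimately have "(\<Sum>l\<in>?A. b $$ l * c $$ (?k - l)) \<noteq> 0"
    using additively_reduced_sum_eq_0[OF S, of ?A "\<lambda>l. b $$ l * c $$ (?k - l)" i] by auto
  then show ?thesis
    by (simp add: fls_support_def fls_times_nth(2))
qed

section \<open>Irreducibility from isolated exponents\<close>

text \<open>Write a large isolated \<open>K\<close> as \<open>i + j\<close>. The larger summand is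
  at least \<open>K/2\<close>, so adding to it any of two fixed exponents of the other factor stays
  in the window of \<open>K\<close>. Both sums would then equal \<open>K\<close>.\<close>

lemma singleton_support_if_isolated:
  fixes b c :: "'a::idom fls"
  assumes S: "semidomain S" "additively_reduced S"
    and bc: "b \<in> laurent_series S" "c \<in> laurent_series S"
    and isolated: "\<And>D. \<exists>K>D. K \<in> fls_support (b * c) \<and>
      (\<forall>n\<in>fls_support (b * c). K \<le> 4 * n \<longrightarrow> n \<le> 2 * K \<longrightarrow> n = K)"
  shows "(\<exists>i. fls_support b \<subseteq> {i}) \<or> (\<exists>i. fls_support c \<subseteq> {i})"
proof (rule ccontr)
  assume "\<not> ?thesis"
  then obtain b0 b1 c0 c1 where
    b01: "b0 \<in> fls_support b" "b1 \<in> fls_support b" "b0 \<noteq> b1" and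
    c01: "c0 \<in> fls_support c" "c1 \<in> fls_support c" "c0 \<noteq> c1"
    by (metis empty_subsetI insert_subset subsetI singleton_iff)
  define D where "D = \<bar>b0\<bar> + \<bar>b1\<bar> + \<bar>c0\<bar> + \<bar>c1\<bar> + \<bar>fls_subdegree b\<bar> + \<bar>fls_subdegree c\<bar>"
  have D: "\<bar>b0\<bar> \<le> D" "\<bar>b1\<bar> \<le> D" "\<bar>c0\<bar> \<le> D" "\<bar>c1\<bar> \<le> D"
    "- D \<le> fls_subdegree b" "- D \<le> fls_subdegree c"
    by (simp_all add: D_def)
  \<comment> \<open>\<open>D\<close> bounds the four exponents and the negative parts of both
    supports, so for \<open>K\<close> this large neither end of the window is crossed below.\<close>
  obtain K where K: "K > 8 * D" "K \<in> fls_support (b * c)"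
    and window: "\<And>n. n \<in> fls_support (b * c) \<Longrightarrow> K \<le> 4 * n \<Longrightarrow> n \<le> 2 * K \<Longrightarrow> n = K"
    using isolated by blast
  obtain i j where ij: "i \<in> fls_support b" "j \<in> fls_support c" "K = i + j"
    using fls_support_times_subset K(2) by blast
  have lower: "- D \<le> i" "- D \<le> j"
    using ij D by (auto simp: fls_support_def intro: order_trans fls_subdegree_leI)
  show False
  proof (cases "K \<le> 2 * j")
    case True
    have "l + j = K" if "l \<in> fls_support b" "\<bar>l\<bar> \<le> D" for l
    proof (rule window[OF fls_support_times_add[OF S bc that(1) ij(2)]])
      show "K \<le> 4 * (l + j)"
        using True K(1) that(2) by presburger
      show "l + j \<le> 2 * K"
        using lower K(1) ij(3) that(2) by linarith
    qed
    from this[OF b01(1) D(1)] this[OF b01(2) D(2)] b01(3) show False by simp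
  next
    case False
    have "i + l = K" if "l \<in> fls_support c" "\<bar>l\<bar> \<le> D" for l
    proof (rule window[OF fls_support_times_add[OF S bc ij(1) that(1)]])
      show "K \<le> 4 * (i + l)"
        using False K(1) ij(3) that(2) by presburger
      show "i + l \<le> 2 * K"
        using lower K(1) ij(3) that(2) by linarith
    qed
    from this[OF c01(1) D(3)] this[OF c01(2) D(4)] c01(3) show False by simp
  qed
qed

text \<open>Here \<open>b\<close> is a monomial with coefficient \<open>\<beta>\<close>, and the
  coefficient of \<open>b * c\<close> at \<open>m\<close> is a multiple of \<open>\<beta>\<close> in
  \<open>S\<close>. As that is a unit, so is \<open>\<beta>\<close>, and the inverse of
  \<open>b\<close> is again a monomial.\<close>

lemma mult_unit_if_singleton_support:
  fixes b c :: "'a::idom fls"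
  assumes S: "semidomain S"
    and bc: "b \<in> laurent_series S" "c \<in> laurent_series S"
    and b: "fls_support b \<subseteq> {i}"
    and unit: "(b * c) $$ m \<in> mult_units S"
  shows "b \<in> mult_units (laurent_series S)"
proof -
  define \<beta> where "\<beta> = b $$ i"
  have b_eq: "b = fls_shift (- i) (fls_const \<beta>)"
    using b by (intro fls_eqI) (auto simp: \<beta>_def fls_support_def)
  obtain w where w: "w \<in> S" "\<beta> * c $$ (m - i) * w = 1"
    using unit by (auto simp: b_eq mult_units_def fls_shifted_times_simps)
  define v where "v = c $$ (m - i) * w"
  have v: "v \<in> S" "\<beta> * v = 1"
    using S bc(2) w by (auto simp: v_def semidomain_def laurent_series_def mult.assoc)
  define d where "d = fls_shift i (fls_const v)"
  have "b * d = 1"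
    using v by (simp add: b_eq d_def fls_times_both_shifted_simp)
  moreover have "d \<in> laurent_series S"
    using S v by (auto simp: d_def laurent_series_def semidomain_def)
  ultimately show ?thesis
    using bc(1) by (auto simp: mult_units_def intro!: bexI[of _ d])
qed

lemma mult_irreducible_if_isolated:
  fixes g :: "'a::idom fls"
  assumes S: "semidomain S" "additively_reduced S"
    and g: "g \<in> laurent_series S"
    and unit: "g $$ m \<in> mult_units S"
    and isolated: "\<And>D. \<exists>K>D. K \<in> fls_support g \<and>
      (\<forall>n\<in>fls_support g. K \<le> 4 * n \<longrightarrow> n \<le> 2 * K \<longrightarrow> n = K)"
  shows "g \<in> mult_irreducibles (laurent_series S)"
  unfolding mult_irreducibles_def
proof (intro CollectI conjI ballI impI g)
  show "g \<noteq> 0"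
    using unit by (auto simp: mult_units_def)
  show "g \<notin> mult_units (laurent_series S)"
  proof
    assume "g \<in> mult_units (laurent_series S)"
    then obtain h where h: "h \<in> laurent_series S" "h \<noteq> 0" "g * h = 1"
      by (auto simp: mult_units_def)
    then obtain j where j: "j \<in> fls_support h"
      by (auto simp: fls_support_def fls_eq_iff)
    \<comment> \<open>The positive exponent \<open>K + j\<close> would have to occur in the support
      of 1.\<close>
    obtain K where K: "K > - j" "K \<in> fls_support g"
      using isolated by blast
    have "K + j \<in> fls_support (g * h)"
      by (rule fls_support_times_add[OF S g h(1) K(2) j])
    then show False
      using K(1) h(3) by (simp add: fls_support_def)
  qed
  fix b c
  assume bc: "b \<in> laurent_series S" "c \<in> laurent_series S" "g = b * c"
  then consider i where "fls_support b \<subseteq> {i}" | i where "fls_support c \<subseteq> {i}"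
    using singleton_support_if_isolated[OF S bc(1,2)] isolated by blast
  then show "b \<in> mult_units (laurent_series S) \<or> c \<in> mult_units (laurent_series S)"
    using mult_unit_if_singleton_support[OF S(1)] unit bc by cases (auto simp: mult.commute)
qed

section \<open>Unit summands and sparse exponents\<close>

text \<open>A decomposition of \<open>a\<close> into atoms is nonempty because \<open>a\<close> is
  nonzero; any one of its atoms is a unit.\<close>

lemma unit_summand:
  assumes "semidomain S" "additively_reduced S" "additively_atomic S"
    and "add_atoms S = mult_units S" and "a \<in> S" "a \<noteq> 0"
  shows "\<exists>u\<in>mult_units S. \<exists>r\<in>S. a = u + r"
proof -
  obtain M where M: "set_mset M \<subseteq> mult_units S" "a = sum_mset M"
    using assms unfolding additively_atomic_def additively_reduced_def
    by (metis DiffI singletonD)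
  have sum_in: "sum_mset N \<in> S" if "set_mset N \<subseteq> S" for N
    using that by (induction N) (use assms(1) in \<open>auto simp: semidomain_def\<close>)
  obtain u N where "M = add_mset u N"
    using M(2) assms(6) by (cases M) auto
  then show ?thesis
    using M sum_in[of N] by (intro bexI[of _ u] bexI[of _ "sum_mset N"]) (auto simp: mult_units_def)
qed

lemma fls_support_unbounded:
  assumes "infinite (fls_support f)"
  shows "\<exists>n\<in>fls_support f. n > D"
proof (rule ccontr)
  assume "\<not> ?thesis"
  then have "fls_support f \<subseteq> {fls_subdegree f..D}"
    by (force simp: fls_support_def intro: fls_subdegree_leI)
  then show False
    using assms finite_subset by blast
qed

text \<open>The factor 8 makes the windows from \<open>K j / 4\<close> to \<open>2 * K j\<close>
  pairwise disjoint.\<close>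

lemma fls_support_rapid_sequence:
  assumes "infinite (fls_support f)"
  shows "\<exists>K::nat \<Rightarrow> int. K 0 > D \<and> (\<forall>j. K j \<in> fls_support f) \<and> (\<forall>j. K (Suc j) > 8 * K j)"
proof -
  have "\<exists>K. \<forall>j. (K j \<in> fls_support f \<and> (j = 0 \<longrightarrow> K j > D)) \<and> K (Suc j) > 8 * K j"
    by (rule dependent_nat_choice) (use fls_support_unbounded[OF assms] in auto)
  then show ?thesis by blast
qed

lemma rapid_sequence_less:
  fixes K :: "nat \<Rightarrow> int"
  assumes "K 0 > 0" "\<And>j. K (Suc j) > 8 * K j"
  shows "K j > 0" and "i < j \<Longrightarrow> K j > 8 * K i"
proof -
  show pos: "K j > 0" for j
    by (induction j) (use assms in \<open>auto intro: less_trans[of 0 "8 * _"]\<close>)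
  show "i < j \<Longrightarrow> K j > 8 * K i"
  proof (induction j)
    case (Suc j)
    then show ?case
      using assms(2)[of j] pos[of j] by (cases "i = j") auto
  qed simp
qed

section \<open>Splitting the series into two irreducible summands\<close>

theorem proposition4p8:
  fixes S :: "'a::idom set" and f :: "'a fls"
  assumes "semidomain S"
    and "additively_reduced S"
    and "additively_atomic S"
    and "add_atoms S = mult_units S"
    and "f \<in> laurent_series S"
    and "infinite (fls_support f)"
  shows "(UNIV :: nat set set) \<lesssim> irreducible_triples S f"
proof -
  note S = assms(1,2)
  have f_in: "f $$ n \<in> S" for n
    using assms(5) by (simp add: laurent_series_def)
  have "0 \<in> S"
    using S by (simp add: semidomain_def)
  obtain p where p: "p \<in> fls_support f"
    using fls_support_unbounded[OF assms(6)] by blast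
  obtain q where q: "q \<in> fls_support f" "q > p"
    using fls_support_unbounded[OF assms(6)] by blast
  obtain u r where u: "u \<in> mult_units S" "r \<in> S" "f $$ p = u + r"
    using unit_summand[OF assms(1-4) f_in[of p]] p by (auto simp: fls_support_def)
  obtain v s where v: "v \<in> mult_units S" "s \<in> S" "f $$ q = v + s"
    using unit_summand[OF assms(1-4) f_in[of q]] q by (auto simp: fls_support_def)
  have uv_in: "u \<in> S" "v \<in> S"
    using u v by (auto simp: mult_units_def)
  \<comment> \<open>This bound on \<open>K 0\<close> places \<open>p\<close> and \<open>q\<close>
    below all windows, so altering the splitting there does not disturb isolation.\<close>
  obtain K :: "nat \<Rightarrow> int" where K0: "K 0 > 4 * \<bar>q\<bar> + 4 * \<bar>p\<bar>"
    and K_supp: "\<And>j. K j \<in> fls_support f" and K_Suc: "\<And>j. K (Suc j) > 8 * K j"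
    using fls_support_rapid_sequence[OF assms(6)] by metis
  have "K 0 > 0"
    using K0 by linarith
  note K_pos = rapid_sequence_less(1)[of K, OF this K_Suc]
    and K_less = rapid_sequence_less(2)[of K, OF this K_Suc]
  define W where "W j = {n. K j \<le> 4 * n \<and> n \<le> 2 * K j}" for j
  have K_in_W: "K j \<in> W j" for j
    using K_pos[of j] by (simp add: W_def)
  have W_disjoint: "i = j" if "n \<in> W i" "n \<in> W j" for i j n
    using that K_less[of i j] K_less[of j i] by (cases i j rule: linorder_cases) (auto simp: W_def)
  have K_ge: "K 0 \<le> K j" for j
    using K_less[of 0 j] K_pos[of 0] by (cases "j = 0") auto
  have W_large: "n \<noteq> p \<and> n \<noteq> q" if "n \<in> W j" for n j
    using that K0 K_ge[of j] by (auto simp: W_def)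
  have K_unbounded: "K j > int j" for j
  proof (induction j)
    case (Suc j)
    then show ?case using K_Suc[of j] by linarith
  qed (use K_pos in simp)

  \<comment> \<open>Residue 0 always isolates \<open>K j\<close> in \<open>g X\<close>, residue 1
    always isolates it in \<open>h X\<close>, and residue 2 encodes the arbitrary set
    \<open>X\<close>.\<close>
  define J where "J X = {j. j mod 3 = 0 \<or> (j mod 3 = 2 \<and> j div 3 \<in> X)}" for X :: "nat set"
  \<comment> \<open>Exponents that go to \<open>g X\<close>: in window \<open>j\<close> only
    \<open>K j\<close> if \<open>j \<in> J X\<close>, otherwise all but \<open>K j\<close>.
    Exponents outside every window go to \<open>h X\<close>, apart from \<open>p\<close> and
    \<open>q\<close>, which are treated separately.\<close>
  define T where "T X = {n. \<exists>j. n \<in> W j \<and> (n = K j \<longleftrightarrow> j \<in> J X)}" for X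
  have T_iff: "n \<in> T X \<longleftrightarrow> (n = K j \<longleftrightarrow> j \<in> J X)" if "n \<in> W j" for n j X
    using that W_disjoint unfolding T_def by blast
  define a where "a X n =
    (if n = p then u else if n = q then s else if n \<in> T X then f $$ n else 0)" for X n
  define b where "b X n =
    (if n = p then r else if n = q then v else if n \<in> T X then 0 else f $$ n)" for X n
  define g where "g X = Abs_fls (a X)" for X
  define h where "h X = Abs_fls (b X)" for X
  have f_0: "f $$ n = 0" if "n < fls_subdegree f" for n
    using that by simp
  have pq: "fls_subdegree f \<le> p" "fls_subdegree f \<le> q"
    using p q by (auto simp: fls_support_def intro: fls_subdegree_leI)
  have g_nth: "g X $$ n = a X n" for X n
    unfolding g_def
    by (rule nth_Abs_fls_lower_bound[of "fls_subdegree f"]) (use pq in \<open>auto simp: a_def\<close>)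
  have h_nth: "h X $$ n = b X n" for X n
    unfolding h_def
    by (rule nth_Abs_fls_lower_bound[of "fls_subdegree f"]) (use pq in \<open>auto simp: b_def\<close>)
  have f_eq: "f = g X + h X" for X
    by (rule fls_eqI) (use u v q in \<open>auto simp: g_nth h_nth a_def b_def add.commute\<close>)

  have g_K: "g X $$ K j = (if j \<in> J X then f $$ K j else 0)"
    and h_K: "h X $$ K j = (if j \<in> J X then 0 else f $$ K j)" for X j
    using W_large[OF K_in_W[of j]] T_iff[OF K_in_W[of j]]
    by (auto simp: g_nth h_nth a_def b_def)

  have "g X \<in> mult_irreducibles (laurent_series S)" for X
  proof (rule mult_irreducible_if_isolated[OF S])
    show "g X \<in> laurent_series S"
      using f_in u v uv_in \<open>0 \<in> S\<close> by (auto simp: laurent_series_def g_nth a_def)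
    show "g X $$ p \<in> mult_units S"
      using u by (simp add: g_nth a_def)
    fix D :: int
    \<comment> \<open>An index of residue 0 with \<open>K j > j \<ge> D\<close>.\<close>
    define j where "j = 3 * nat D"
    have j: "j \<in> J X"
      by (simp add: J_def j_def)
    show "\<exists>K>D. K \<in> fls_support (g X) \<and>
      (\<forall>n\<in>fls_support (g X). K \<le> 4 * n \<longrightarrow> n \<le> 2 * K \<longrightarrow> n = K)"
    proof (intro exI[of _ "K j"] conjI ballI impI)
      show "K j > D"
        using K_unbounded[of j] by (simp add: j_def split: if_splits)
      show "K j \<in> fls_support (g X)"
        using K_supp[of j] j by (simp add: fls_support_def g_K)
      fix n assume n: "n \<in> fls_support (g X)" "K j \<le> 4 * n" "n \<le> 2 * K j"
      then have "n \<in> W j" by (simp add: W_def)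
      then show "n = K j"
        using n(1) j W_large[of n j] T_iff[of n j X]
        by (auto simp: fls_support_def g_nth a_def split: if_splits)
    qed
  qed
  moreover have "h X \<in> mult_irreducibles (laurent_series S)" for X
  proof (rule mult_irreducible_if_isolated[OF S])
    show "h X \<in> laurent_series S"
      using f_in u v uv_in \<open>0 \<in> S\<close> by (auto simp: laurent_series_def h_nth b_def)
    show "h X $$ q \<in> mult_units S"
      using v q by (simp add: h_nth b_def)
    fix D :: int
    \<comment> \<open>Residue 1 keeps \<open>j\<close> out of \<open>J X\<close>, so
      \<open>K j\<close> is the one exponent of its window left to \<open>h X\<close>.\<close>
    define j where "j = 3 * nat D + 1"
    have j: "j \<notin> J X"
      by (simp add: J_def j_def mod_Suc)
    show "\<exists>K>D. K \<in> fls_support (h X) \<and>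
      (\<forall>n\<in>fls_support (h X). K \<le> 4 * n \<longrightarrow> n \<le> 2 * K \<longrightarrow> n = K)"
    proof (intro exI[of _ "K j"] conjI ballI impI)
      show "K j > D"
        using K_unbounded[of j] by (simp add: j_def split: if_splits)
      show "K j \<in> fls_support (h X)"
        using K_supp[of j] j by (simp add: fls_support_def h_K)
      fix n assume n: "n \<in> fls_support (h X)" "K j \<le> 4 * n" "n \<le> 2 * K j"
      then have "n \<in> W j" by (simp add: W_def)
      then show "n = K j"
        using n(1) j W_large[of n j] T_iff[of n j X]
        by (auto simp: fls_support_def h_nth b_def split: if_splits)
    qed
  qed
  ultimately have triples: "{#g X, h X, 0#} \<in> irreducible_triples S f" for X
    using f_eq[of X] by (auto simp: irreducible_triples_def)

  have "inj (\<lambda>X. {#g X, h X, 0#})"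
  proof (rule injI)
    fix X Y assume eq: "{#g X, h X, 0#} = {#g Y, h Y, 0#}"
    \<comment> \<open>The triples are unordered, so \<open>g X\<close> could a priori equal
      \<open>h Y\<close> or \<open>0\<close>. Since 0 belongs to every \<open>J X\<close>, the
      coefficient at \<open>K 0\<close> excludes both.\<close>
    have "g X \<in># {#g Y, h Y, 0#}"
      by (simp flip: eq)
    moreover have "g X $$ K 0 \<noteq> 0" "h Y $$ K 0 = 0"
      using K_supp[of 0] by (simp_all add: g_K h_K fls_support_def J_def)
    ultimately have g_eq: "g X = g Y"
      by auto
    have "j \<in> J X \<longleftrightarrow> j \<in> J Y" for j
      using arg_cong[OF g_eq, of "\<lambda>g. g $$ K j"] K_supp[of j]
      by (simp add: g_K fls_support_def split: if_splits)
    moreover have "i \<in> Z \<longleftrightarrow> 3 * i + 2 \<in> J Z" for i Z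
    proof -
      have "(3 * i + 2) mod 3 = 2" "(3 * i + 2) div 3 = i"
        by presburger+
      then show ?thesis
        unfolding J_def by simp
    qed
    ultimately show "X = Y" by blast
  qed
  then show ?thesis
    unfolding lepoll_def using triples by blast
qed

end
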